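(* Let $L\subseteq\Sigma^*$ be a regular language and let $\delta:=\mathfrak{sc}(\mathbf{dfa}_{\mathbf{Syn}(L)})$. 1. The map $\lambda\delta_U.\ \{[\![u]\!]_{\mathcal S_L}:u\in U\}:\mathbf{TS}(\delta)\to\mathcal P\,\mathbf{Syn}(L)$ is a well-defined isomorphism of semirings. 2. The acceptance map is a $\mathsf{JSL}$-dfa isomorphism $\mathrm{acc}_{(\mathfrak{ts}(\delta))^\star}:(\mathfrak{ts}(\delta))^\star\to\mathfrak{dfa}^{\neg}_{\mathsf{Syn}}(L^r)$.
   Context: Fix an alphabet $\Sigma$. $L^r$ is the reversed language; $u^{-1}Lv^{-1}=\{w:uwv\in L\}$. A $\mathsf{JSL}$-dfa is $(s_0,\mathbb S,\delta_a,F)$ with $\mathbb S$ a finite join-semilattice (with bottom), $s_0\in S$, $\delta_a$ ($a\in\Sigma$) endomorphisms preserving all finite joins, $F=\{s:s\nleq t\}$ for some $t\in S$. Morphisms preserve all finite joins and the initial state, commute with transitions, and preserve and reflect final states. $\mathrm{acc}_\delta(s)$ is the language accepted starting from state $s$. The dual of $(s_0,\mathbb S,\delta_a,F)$ is $(s_0,\mathbb S,\delta_a,F)^\star:=(\bigvee_{\mathbb S}\overline F,\mathbb S^{\mathrm{op}},(\delta_a)_*,\{s:s_0\nleq_{\mathbb S}s\})$, where $\mathbb S^{\mathrm{op}}$ is the order-dual and $(\delta_a)_*(t)=\bigvee_{\mathbb S}\{s:\delta_a(s)\leq t\}$. Syntactic congruence: $\mathcal S_L(u,v)\iff\forall x,y\in\Sigma^*.[xuy\in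 L\iff xvy\in L]$; $\mathbf{Syn}(L)=\Sigma^*/\mathcal S_L$ is the (finite) syntactic monoid. $\mathbf{dfa}_{\mathbf{Syn}(L)}$ is the dfa with states $\Sigma^*/\mathcal S_L$, initial state $[\![\varepsilon]\!]$, transitions $x\mapsto x\cdot[\![a]\!]$, final states $\{[\![w]\!]:w\in L\}$. For a finite monoid $\mathbf M$, $\mathcal P\mathbf M$ is the idempotent semiring of subsets under union and elementwise product. For an nfa (or dfa) $\mathcal N=(I,Z,\mathcal N_a,F)$, the full subset construction is $\mathfrak{sc}(\mathcal N)=(I,(\mathcal PZ,\cup,\emptyset),\lambda X.\mathcal N_a[X],\{X:X\cap F\neq\emptyset\})$. For a $\mathsf{JSL}$-dfa $\delta$ put $\delta_\varepsilon=\mathrm{id}$, $\delta_{wa}=\delta_a\circ\delta_w$, $\delta_K=\lambda s.\bigvee\{\delta_w(s):w\in K\}$ for $K\subseteq\Sigma^*$. $\mathbf{TS}(\delta)$ is the idempotent semiring on $\{\delta_K:K\subseteq\Sigma^*\}$ with pointwise join ($\delta_U\vee\delta_V=\delta_{U\cup V}$), unit $\mathrm{id}$ and multiplication in diagrammatic order, $\delta_U\cdot\delta_V:=\delta_V\circ\delta_U=\delta_{UV}$. $\mathfrak{ts}(\delta)$ is the $\mathsf{JSL}$-dfa $(\mathrm{id},\{\delta_K\},\lambda f.\delta_a\circ f,\{f:f\nleq\delta_{\overline{L(\delta)}}\})$ with pointwise order, where $L(\delta)$ is the language accepted by $\delta$ and $\overline{L(\delta)}$ its complement. For a regular language $K$,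 $\mathsf{LRP}(K)$ is the closure of $\{u^{-1}Kv^{-1}:u,v\in\Sigma^*\}$ under the set-theoretic boolean operations (in $\mathcal P\Sigma^*$), and $\mathfrak{dfa}^{\neg}_{\mathsf{Syn}}(K)=(K,(\mathsf{LRP}(K),\cup,\emptyset),\lambda X.a^{-1}X,\{X:\varepsilon\in X\})$. *)

theory Defs
  imports "HOL-Algebra.Lattice" "HOL-Algebra.Coset" "HOL-Algebra.QuotRing"
begin

section \<open>Automata and regular languages\<close>

text \<open>
  The alphabet is an explicit set of letters, written \<open>A\<close> below; words are elements of
  \<open>lists A\<close>, and transitions only matter for letters in \<open>A\<close>.
\<close>

record ('q, 'a) dfa =
  dfa_states :: "'q set"
  dfa_init :: 'q
  dfa_step :: "'a \<Rightarrow> 'q \<Rightarrow> 'q"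
  dfa_final :: "'q set"

record ('q, 'a) nfa =
  nfa_states :: "'q set"
  nfa_init :: "'q set"
  nfa_step :: "'a \<Rightarrow> ('q \<times> 'q) set"
  nfa_final :: "'q set"

definition nfa_of_dfa :: "('q, 'a) dfa \<Rightarrow> ('q, 'a) nfa" where
  "nfa_of_dfa M =
     \<lparr> nfa_states = dfa_states M,
       nfa_init = {dfa_init M},
       nfa_step = (\<lambda>a. {(q, dfa_step M a q) | q. q \<in> dfa_states M}),
       nfa_final = dfa_final M \<rparr>"

definition finite_dfa :: "'a set \<Rightarrow> ('q, 'a) dfa \<Rightarrow> bool" where
  "finite_dfa A M \<longleftrightarrow>
     finite (dfa_states M) \<and> dfa_init M \<in> dfa_states M \<and>
     (\<forall>a\<in>A. dfa_step M a \<in> dfa_states M \<rightarrow> dfa_states M) \<and> dfa_final M \<subseteq> dfa_states M"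

definition dfa_lang :: "'a set \<Rightarrow> ('q, 'a) dfa \<Rightarrow> 'a list set" where
  "dfa_lang A M = {w \<in> lists A. fold (dfa_step M) w (dfa_init M) \<in> dfa_final M}"

text \<open>States of a finite automaton can be numbered, so automata over \<open>nat\<close> suffice.\<close>

definition regular :: "'a set \<Rightarrow> 'a list set \<Rightarrow> bool" where
  "regular A L \<longleftrightarrow> (\<exists>M :: (nat, 'a) dfa. finite_dfa A M \<and> dfa_lang A M = L)"


section \<open>JSL-dfas\<close>

text \<open>
  Join-semilattices are given by their order; finite joins (including the bottom element, the
  empty join) are the suprema \<open>\<Squnion>\<^bsub>P\<^esub> X\<close>. A semilattice written algebraically as
  \<open>(P, \<union>, \<emptyset>)\<close> is thus represented by \<open>P\<close> ordered by inclusion.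
\<close>

definition finite_jsl :: "'s gorder \<Rightarrow> bool" where
  "finite_jsl P \<longleftrightarrow> upper_semilattice P \<and> weak_partial_order_bottom P \<and> finite (carrier P)"

definition jsl_hom :: "'s gorder \<Rightarrow> 't gorder \<Rightarrow> ('s \<Rightarrow> 't) set" where
  "jsl_hom P Q = {f \<in> carrier P \<rightarrow> carrier Q.
     \<forall>X. finite X \<and> X \<subseteq> carrier P \<longrightarrow> f (\<Squnion>\<^bsub>P\<^esub> X) = \<Squnion>\<^bsub>Q\<^esub> (f ` X)}"

record ('s, 'a) jdfa =
  jinit :: 's
  jlat :: "'s gorder"
  jstep :: "'a \<Rightarrow> 's \<Rightarrow> 's"
  jfinal :: "'s set"

abbreviation jstates :: "('s, 'a) jdfa \<Rightarrow> 's set" where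
  "jstates D \<equiv> carrier (jlat D)"

definition jsl_dfa :: "'a set \<Rightarrow> ('s, 'a) jdfa \<Rightarrow> bool" where
  "jsl_dfa A D \<longleftrightarrow>
     finite_jsl (jlat D) \<and> jinit D \<in> jstates D \<and>
     (\<forall>a\<in>A. jstep D a \<in> jsl_hom (jlat D) (jlat D)) \<and>
     (\<exists>t\<in>jstates D. jfinal D = {s \<in> jstates D. \<not> s \<sqsubseteq>\<^bsub>jlat D\<^esub> t})"

definition jdfa_hom :: "'a set \<Rightarrow> ('s, 'a) jdfa \<Rightarrow> ('t, 'a) jdfa \<Rightarrow> ('s \<Rightarrow> 't) set" where
  "jdfa_hom A D E = {f \<in> jsl_hom (jlat D) (jlat E).
     f (jinit D) = jinit E \<and>
     (\<forall>a\<in>A. \<forall>s\<in>jstates D. f (jstep D a s) = jstep E a (f s)) \<and>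
     (\<forall>s\<in>jstates D. f s \<in> jfinal E \<longleftrightarrow> s \<in> jfinal D)}"

text \<open>Isomorphism in the category of JSL-dfas.\<close>

definition jdfa_iso :: "'a set \<Rightarrow> ('s, 'a) jdfa \<Rightarrow> ('t, 'a) jdfa \<Rightarrow> ('s \<Rightarrow> 't) set" where
  "jdfa_iso A D E = {f. jsl_dfa A D \<and> jsl_dfa A E \<and> f \<in> jdfa_hom A D E \<and>
     (\<exists>g \<in> jdfa_hom A E D. (\<forall>s\<in>jstates D. g (f s) = s) \<and> (\<forall>t\<in>jstates E. f (g t) = t))}"

text \<open>\<open>jrun D w\<close> is $\delta_w$: letters are processed from left to right.\<close>

definition jrun :: "('s, 'a) jdfa \<Rightarrow> 'a list \<Rightarrow> 's \<Rightarrow> 's" where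
  "jrun D w = fold (jstep D) w"

definition acc :: "'a set \<Rightarrow> ('s, 'a) jdfa \<Rightarrow> 's \<Rightarrow> 'a list set" where
  "acc A D s = {w \<in> lists A. jrun D w s \<in> jfinal D}"

definition jlang :: "'a set \<Rightarrow> ('s, 'a) jdfa \<Rightarrow> 'a list set" where
  "jlang A D = acc A D (jinit D)"

definition jdual :: "('s, 'a) jdfa \<Rightarrow> ('s, 'a) jdfa" where
  "jdual D =
     \<lparr> jinit = \<Squnion>\<^bsub>jlat D\<^esub> (jstates D - jfinal D),
       jlat = inv_gorder (jlat D),
       jstep = (\<lambda>a t. \<Squnion>\<^bsub>jlat D\<^esub> {s \<in> jstates D. jstep D a s \<sqsubseteq>\<^bsub>jlat D\<^esub> t}),
       jfinal = {s \<in> jstates D. \<not> jinit D \<sqsubseteq>\<^bsub>jlat D\<^esub> s} \<rparr>"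

definition subset_construction :: "('q, 'a) nfa \<Rightarrow> ('q set, 'a) jdfa" where
  "subset_construction N =
     \<lparr> jinit = nfa_init N,
       jlat = \<lparr> carrier = Pow (nfa_states N), eq = (=), le = (\<subseteq>) \<rparr>,
       jstep = (\<lambda>a X. nfa_step N a `` X),
       jfinal = {X \<in> Pow (nfa_states N). X \<inter> nfa_final N \<noteq> {}} \<rparr>"


section \<open>The transition semiring and its JSL-dfa\<close>

text \<open>
  \<open>jact D K\<close> is $\delta_K$. Functions on the state set are represented extensionally (undefined
  outside of it), so that equality of functions is equality on states.
\<close>

definition jact :: "('s, 'a) jdfa \<Rightarrow> 'a list set \<Rightarrow> 's \<Rightarrow> 's" where
  "jact D K = (\<lambda>s\<in>jstates D. \<Squnion>\<^bsub>jlat D\<^esub> {jrun D w s | w. w \<in> K})"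

definition TS_carrier :: "'a set \<Rightarrow> ('s, 'a) jdfa \<Rightarrow> ('s \<Rightarrow> 's) set" where
  "TS_carrier A D = {jact D K | K. K \<subseteq> lists A}"

definition TS :: "'a set \<Rightarrow> ('s, 'a) jdfa \<Rightarrow> ('s \<Rightarrow> 's) ring" where
  "TS A D =
     \<lparr> carrier = TS_carrier A D,
       mult = (\<lambda>f g. compose (jstates D) g f),
       one = (\<lambda>s\<in>jstates D. s),
       zero = (\<lambda>s\<in>jstates D. \<bottom>\<^bsub>jlat D\<^esub>),
       add = (\<lambda>f g. \<lambda>s\<in>jstates D. f s \<squnion>\<^bsub>jlat D\<^esub> g s) \<rparr>"

definition ts :: "'a set \<Rightarrow> ('s, 'a) jdfa \<Rightarrow> ('s \<Rightarrow> 's, 'a) jdfa" where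
  "ts A D =
     (let le_pw = (\<lambda>f g. \<forall>s\<in>jstates D. f s \<sqsubseteq>\<^bsub>jlat D\<^esub> g s) in
     \<lparr> jinit = (\<lambda>s\<in>jstates D. s),
       jlat = \<lparr> carrier = TS_carrier A D, eq = (=), le = le_pw \<rparr>,
       jstep = (\<lambda>a f. compose (jstates D) (jstep D a) f),
       jfinal = {f \<in> TS_carrier A D. \<not> le_pw f (jact D (lists A - jlang A D))} \<rparr>)"


section \<open>Idempotent semirings\<close>

definition idem_semiring :: "('r, 'm) ring_scheme \<Rightarrow> bool" where
  "idem_semiring R \<longleftrightarrow> semiring R \<and> (\<forall>x\<in>carrier R. x \<oplus>\<^bsub>R\<^esub> x = x)"

text \<open>The set \<^const>\<open>ring_iso\<close> does not mention the zero element, so its preservation is added.\<close>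

definition idem_semiring_iso ::
  "('r, 'm) ring_scheme \<Rightarrow> ('s, 'n) ring_scheme \<Rightarrow> ('r \<Rightarrow> 's) set" where
  "idem_semiring_iso R S =
     {h. idem_semiring R \<and> idem_semiring S \<and> h \<in> ring_iso R S \<and> h \<zero>\<^bsub>R\<^esub> = \<zero>\<^bsub>S\<^esub>}"

definition power_semiring :: "('m, 'b) monoid_scheme \<Rightarrow> 'm set ring" where
  "power_semiring M =
     \<lparr> carrier = Pow (carrier M),
       mult = (\<lambda>X Y. X <#>\<^bsub>M\<^esub> Y),
       one = {\<one>\<^bsub>M\<^esub>},
       zero = {},
       add = (\<union>) \<rparr>"


section \<open>The syntactic monoid\<close>

definition synt_cong :: "'a set \<Rightarrow> 'a list set \<Rightarrow> ('a list \<times> 'a list) set" where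
  "synt_cong A L = {(u, v). u \<in> lists A \<and> v \<in> lists A \<and>
     (\<forall>x\<in>lists A. \<forall>y\<in>lists A. x @ u @ y \<in> L \<longleftrightarrow> x @ v @ y \<in> L)}"

definition synt_class :: "'a set \<Rightarrow> 'a list set \<Rightarrow> 'a list \<Rightarrow> 'a list set" where
  "synt_class A L w = synt_cong A L `` {w}"

definition Syn :: "'a set \<Rightarrow> 'a list set \<Rightarrow> 'a list set monoid" where
  "Syn A L =
     \<lparr> carrier = lists A // synt_cong A L,
       mult = (\<lambda>X Y. \<Union>u\<in>X. \<Union>v\<in>Y. synt_class A L (u @ v)),
       one = synt_class A L [] \<rparr>"

definition dfa_Syn :: "'a set \<Rightarrow> 'a list set \<Rightarrow> ('a list set, 'a) dfa" where
  "dfa_Syn A L =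
     \<lparr> dfa_states = carrier (Syn A L),
       dfa_init = synt_class A L [],
       dfa_step = (\<lambda>a X. X \<otimes>\<^bsub>Syn A L\<^esub> synt_class A L [a]),
       dfa_final = {synt_class A L w | w. w \<in> L} \<rparr>"


section \<open>The boolean syntactic JSL-dfa\<close>

definition two_sided_quotient :: "'a set \<Rightarrow> 'a list \<Rightarrow> 'a list set \<Rightarrow> 'a list \<Rightarrow> 'a list set" where
  "two_sided_quotient A u K v = {w \<in> lists A. u @ w @ v \<in> K}"

inductive_set LRP :: "'a set \<Rightarrow> 'a list set \<Rightarrow> 'a list set set"
  for A :: "'a set" and K :: "'a list set" where
  quot: "u \<in> lists A \<Longrightarrow> v \<in> lists A \<Longrightarrow> two_sided_quotient A u K v \<in> LRP A K"
| empty: "{} \<in> LRP A K"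
| full: "lists A \<in> LRP A K"
| compl: "X \<in> LRP A K \<Longrightarrow> lists A - X \<in> LRP A K"
| union: "X \<in> LRP A K \<Longrightarrow> Y \<in> LRP A K \<Longrightarrow> X \<union> Y \<in> LRP A K"
| inter: "X \<in> LRP A K \<Longrightarrow> Y \<in> LRP A K \<Longrightarrow> X \<inter> Y \<in> LRP A K"

definition dfa_neg_Syn :: "'a set \<Rightarrow> 'a list set \<Rightarrow> ('a list set, 'a) jdfa" where
  "dfa_neg_Syn A K =
     \<lparr> jinit = K,
       jlat = \<lparr> carrier = LRP A K, eq = (=), le = (\<subseteq>) \<rparr>,
       jstep = (\<lambda>a X. two_sided_quotient A [a] X []),
       jfinal = {X \<in> LRP A K. [] \<in> X} \<rparr>"

end

theory Submission
  imports Defs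
begin

text \<open>
  The full subset construction of the syntactic dfa acts by right multiplication: $\delta_U$ sends
  a set \<open>X\<close> of syntactic classes to $X\cdot[U]$. Evaluating at the singleton of the unit recovers
  $[U]$, so the transition semiring is the power semiring of the syntactic monoid and its pointwise
  order is inclusion. In the dual, the adjoint of $\delta_a$ sends \<open>S\<close> to
  $\{m : m\cdot[a]\in S\}$, hence the state \<open>S\<close> accepts the words \<open>w\<close> with
  $[w^r]\notin S$. The sets $\{w : [w^r]\in S\}$ are exactly the members of
  $\mathsf{LRP}(L^r)$, because each syntactic class is a boolean combination of the
  finitely many two-sided quotients of \<open>L\<close>.
\<close>

section \<open>Suprema in finite semilattices\<close>

text \<open>The supremum operator is a Hilbert choice among least upper bounds. Antisymmetry makes
  the choice unique, so exhibiting one least upper bound computes it.\<close>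

lemma (in partial_order) sup_eq:
  assumes "is_lub L s X"
  shows "\<Squnion>X = s"
proof -
  have "is_lub L (\<Squnion>X) X"
    unfolding sup_def using assms by (rule someI)
  then show ?thesis
    using assms weak_least_unique eq_is_equal by metis
qed

text \<open>Made for the dual automaton, whose initial state and transitions are joins of principal
  ideals: each such join is the generator of the ideal.\<close>

lemma (in partial_order) sup_greatest:
  assumes "greatest L s X"
  shows "\<Squnion>X = s"
  by (rule sup_eq) (use assms in \<open>auto simp: least_def greatest_def Upper_def\<close>)

text \<open>Every element bounds the empty set, so its least upper bound is the bottom; binary joins
  give the nonempty finite joins by induction. Finiteness of the carrier turns this into existence
  of all joins.\<close>

lemma finite_jsl_iff:
  "finite_jsl P \<longleftrightarrow>
     partial_order P \<and> finite (carrier P) \<and> (\<forall>X\<subseteq>carrier P. \<exists>s. is_lub P s X)"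
    (is "?l \<longleftrightarrow> ?r")
proof
  assume ?l
  then interpret upper_semilattice P + weak_partial_order_bottom P
    by (auto simp: finite_jsl_def)
  have "\<exists>s. is_lub P s X" if "X \<subseteq> carrier P" for X
  proof (cases "X = {}")
    case True
    then show ?thesis
      using bottom_exists by (simp add: Upper_def)
  next
    case False
    have "finite X"
      using that \<open>?l\<close> finite_subset by (auto simp: finite_jsl_def)
    then show ?thesis
      using that False finite_sup_least by blast
  qed
  then show ?r
    using \<open>?l\<close> partial_order_axioms by (auto simp: finite_jsl_def)
next
  assume r: ?r
  then interpret partial_order P
    by simp
  have "\<exists>s. is_lub P s {x, y}" if "x \<in> carrier P" "y \<in> carrier P" for x y
    using r that by simp
  moreover have "\<exists>s. least P s (carrier P)"
    using r[THEN conjunct2, THEN conjunct2, THEN spec, of "{}"] by (simp add: Upper_def)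
  ultimately show ?l
    using r unfolding finite_jsl_def by (auto intro!: upper_semilattice.intro
        upper_semilattice_axioms.intro weak_partial_order_bottom.intro
        weak_partial_order_bottom_axioms.intro partial_order_axioms weak_partial_order_axioms)
qed

section \<open>Transport of joins and JSL-dfa structure along order isomorphisms\<close>

lemma is_lub_order_iso:
  assumes bij: "bij_betw f (carrier P) (carrier Q)"
    and le: "\<And>x y. x \<in> carrier P \<Longrightarrow> y \<in> carrier P \<Longrightarrow> f x \<sqsubseteq>\<^bsub>Q\<^esub> f y \<longleftrightarrow> x \<sqsubseteq>\<^bsub>P\<^esub> y"
    and X: "X \<subseteq> carrier P" and s: "s \<in> carrier P"
  shows "is_lub Q (f s) (f ` X) \<longleftrightarrow> is_lub P s X"
proof -
  have Q: "carrier Q = f ` carrier P" and inj: "inj_on f (carrier P)"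
    using bij by (auto simp: bij_betw_def)
  have "f u \<in> Upper Q (f ` X) \<longleftrightarrow> u \<in> Upper P X" if "u \<in> carrier P" for u
    using X le that unfolding Upper_def Q by blast
  then have "Upper Q (f ` X) = f ` Upper P X"
    unfolding Q Upper_def by blast
  then show ?thesis
    using s le inj unfolding least_def Q by (auto simp: inj_on_image_mem_iff Upper_def)
qed

lemma partial_order_inclusion: "partial_order \<lparr>carrier = C, eq = (=), le = (\<subseteq>)\<rparr>"
  by unfold_locales auto

lemma is_lub_inclusion:
  assumes "X \<subseteq> C" "\<Union>X \<in> C"
  shows "is_lub \<lparr>carrier = C, eq = (=), le = (\<subseteq>)\<rparr> (\<Union>X) X"
  using assms by (auto simp: least_def Upper_def)

lemma sup_inclusion:
  assumes "X \<subseteq> C" "\<Union>X \<in> C"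
  shows "\<Squnion>\<^bsub>\<lparr>carrier = C, eq = (=), le = (\<subseteq>)\<rparr>\<^esub> X = \<Union>X"
  using partial_order.sup_eq[OF partial_order_inclusion is_lub_inclusion[OF assms]] .

text \<open>Everything that makes \<open>D\<close> a JSL-dfa is transported from \<open>E\<close> along the order isomorphism.\<close>

lemma jdfa_isoI:
  assumes E: "jsl_dfa A E" and po: "partial_order (jlat D)"
    and bij: "bij_betw f (jstates D) (jstates E)"
    and le: "\<And>x y. x \<in> jstates D \<Longrightarrow> y \<in> jstates D \<Longrightarrow>
      f x \<sqsubseteq>\<^bsub>jlat E\<^esub> f y \<longleftrightarrow> x \<sqsubseteq>\<^bsub>jlat D\<^esub> y"
    and init: "jinit D \<in> jstates D" "f (jinit D) = jinit E"
    and step: "\<And>a x. a \<in> A \<Longrightarrow> x \<in> jstates D \<Longrightarrow> jstep D a x \<in> jstates D"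
      "\<And>a x. a \<in> A \<Longrightarrow> x \<in> jstates D \<Longrightarrow> f (jstep D a x) = jstep E a (f x)"
    and final: "jfinal D \<subseteq> jstates D"
      "\<And>x. x \<in> jstates D \<Longrightarrow> f x \<in> jfinal E \<longleftrightarrow> x \<in> jfinal D"
  shows "f \<in> jdfa_iso A D E"
proof -
  define g where "g = inv_into (jstates D) f"
  have fE: "f x \<in> jstates E" if "x \<in> jstates D" for x
    using bij that by (auto simp: bij_betw_def)
  have gf: "g (f x) = x" if "x \<in> jstates D" for x
    unfolding g_def using bij that by (simp add: bij_betw_inv_into_left)
  have fg: "f (g y) = y" and gD: "g y \<in> jstates D" if "y \<in> jstates E" for y
    using bij that bij_betw_inv_into[OF bij] unfolding g_def
    by (auto simp: bij_betw_inv_into_right bij_betw_def)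
  have bijg: "bij_betw g (jstates E) (jstates D)"
    unfolding g_def by (rule bij_betw_inv_into[OF bij])
  have fXE: "f ` X \<subseteq> jstates E" if "X \<subseteq> jstates D" for X
    using that fE by auto
  have gXD: "g ` X \<subseteq> jstates D" if "X \<subseteq> jstates E" for X
    using that gD by auto
  interpret E: partial_order "jlat E"
    using E by (simp add: jsl_dfa_def finite_jsl_iff)
  have lubE: "\<exists>s. is_lub (jlat E) s Y" if "Y \<subseteq> jstates E" for Y
    using E that by (simp add: jsl_dfa_def finite_jsl_iff)
  have stepE: "jstep E a (\<Squnion>\<^bsub>jlat E\<^esub> Y) = \<Squnion>\<^bsub>jlat E\<^esub> (jstep E a ` Y)"
    if "a \<in> A" "finite Y" "Y \<subseteq> jstates E" for a Y
    using E that by (auto simp: jsl_dfa_def jsl_hom_def)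
  have lubf: "is_lub (jlat E) (f s) (f ` X) \<longleftrightarrow> is_lub (jlat D) s X"
    if "X \<subseteq> jstates D" "s \<in> jstates D" for s X
    using is_lub_order_iso[OF bij le] that by blast
  have lubD: "\<exists>s\<in>jstates D. is_lub (jlat D) s X" if X: "X \<subseteq> jstates D" for X
  proof -
    obtain t where t: "is_lub (jlat E) t (f ` X)"
      using lubE fXE[OF X] by blast
    then have "is_lub (jlat D) (g t) X"
      using lubf[OF X, of "g t"] gD[of t] fg[of t] least_closed[of "jlat E"] by auto
    then show ?thesis
      using gD[of t] t least_closed[of "jlat E"] by auto
  qed
  have f_sup: "f (\<Squnion>\<^bsub>jlat D\<^esub> X) = \<Squnion>\<^bsub>jlat E\<^esub> (f ` X)" "\<Squnion>\<^bsub>jlat D\<^esub> X \<in> jstates D"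
    if X: "X \<subseteq> jstates D" for X
  proof -
    obtain s where s: "s \<in> jstates D" "is_lub (jlat D) s X"
      using lubD[OF X] by blast
    then have "is_lub (jlat E) (f s) (f ` X)"
      using lubf[OF X] by blast
    then show "f (\<Squnion>\<^bsub>jlat D\<^esub> X) = \<Squnion>\<^bsub>jlat E\<^esub> (f ` X)" "\<Squnion>\<^bsub>jlat D\<^esub> X \<in> jstates D"
      using s E.sup_eq partial_order.sup_eq[OF po] by auto
  qed
  have g_sup: "g (\<Squnion>\<^bsub>jlat E\<^esub> Y) = \<Squnion>\<^bsub>jlat D\<^esub> (g ` Y)" if Y: "Y \<subseteq> jstates E" for Y
  proof -
    have "f ` g ` Y = (\<lambda>y. y) ` Y"
      unfolding image_image by (rule image_cong) (use fg Y in auto)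
    then have "\<Squnion>\<^bsub>jlat E\<^esub> Y = f (\<Squnion>\<^bsub>jlat D\<^esub> (g ` Y))"
      using f_sup(1)[OF gXD[OF Y]] by simp
    then show ?thesis
      using gf[OF f_sup(2)[OF gXD[OF Y]]] by simp
  qed
  have step_sup: "jstep D a (\<Squnion>\<^bsub>jlat D\<^esub> X) = \<Squnion>\<^bsub>jlat D\<^esub> (jstep D a ` X)"
    if a: "a \<in> A" and X: "finite X" "X \<subseteq> jstates D" for a X
  proof -
    have sX: "jstep D a ` X \<subseteq> jstates D"
      using step(1)[OF a] X by auto
    \<comment> \<open>Both sides of the goal are compared after applying \<open>f\<close>, which
      moves the computation into \<open>E\<close>; injectivity of \<open>f\<close> then removes
      it.\<close>
    have "f (jstep D a (\<Squnion>\<^bsub>jlat D\<^esub> X)) = jstep E a (\<Squnion>\<^bsub>jlat E\<^esub> (f ` X))"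
      using step(2)[OF a] f_sup X by simp
    also have "\<dots> = \<Squnion>\<^bsub>jlat E\<^esub> (jstep E a ` f ` X)"
      using stepE[OF a _ fXE] X by simp
    also have "jstep E a ` f ` X = f ` jstep D a ` X"
      unfolding image_image by (rule image_cong) (use step(2)[OF a] X in auto)
    also have "\<Squnion>\<^bsub>jlat E\<^esub> (f ` jstep D a ` X) = f (\<Squnion>\<^bsub>jlat D\<^esub> (jstep D a ` X))"
      using f_sup(1)[OF sX] by simp
    finally show ?thesis
      using bij_betw_imp_inj_on[OF bij] step(1)[OF a f_sup(2)[OF X(2)]] f_sup(2)[OF sX]
      by (simp add: inj_on_eq_iff)
  qed
  have "jsl_dfa A D"
    unfolding jsl_dfa_def
  proof (intro conjI ballI)
    show "finite_jsl (jlat D)"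
    proof -
      have "finite (jstates D)"
        using E bij_betw_finite[OF bij] by (simp add: finite_jsl_iff jsl_dfa_def)
      then show ?thesis
        using po lubD unfolding finite_jsl_iff by blast
    qed
    show "jinit D \<in> jstates D"
      by (rule init)
    show "jstep D a \<in> jsl_hom (jlat D) (jlat D)" if "a \<in> A" for a
      using that step step_sup by (auto simp: jsl_hom_def)
    obtain t where t: "t \<in> jstates E" "jfinal E = {s \<in> jstates E. \<not> s \<sqsubseteq>\<^bsub>jlat E\<^esub> t}"
      using E by (auto simp: jsl_dfa_def)
    \<comment> \<open>The threshold that cuts out the final states of \<open>E\<close> is pulled
      back through the inverse \<open>g\<close>.\<close>
    have "jfinal D = {s \<in> jstates D. \<not> s \<sqsubseteq>\<^bsub>jlat D\<^esub> g t}"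
      using t final le[of _ "g t"] fg[OF t(1)] gD[OF t(1)] fE by auto
    then show "\<exists>t\<in>jstates D. jfinal D = {s \<in> jstates D. \<not> s \<sqsubseteq>\<^bsub>jlat D\<^esub> t}"
      using gD[OF t(1)] by blast
  qed
  moreover have "f \<in> jdfa_hom A D E"
    using fE f_sup init step final by (auto simp: jdfa_hom_def jsl_hom_def)
  moreover have "g \<in> jdfa_hom A E D"
  proof -
    have "g (jstep E a y) = jstep D a (g y)" if "a \<in> A" "y \<in> jstates E" for a y
      using step gD[OF that(2)] fg[OF that(2)] gf that(1) by metis
    moreover have "g y \<in> jfinal D \<longleftrightarrow> y \<in> jfinal E" if "y \<in> jstates E" for y
      using final(2)[OF gD[OF that]] fg[OF that] by simp
    moreover have "g (jinit E) = jinit D"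
      using init gf by metis
    ultimately show ?thesis
      using gD g_sup by (auto simp: jdfa_hom_def jsl_hom_def)
  qed
  ultimately show ?thesis
    using E gf fg by (auto simp: jdfa_iso_def)
qed

section \<open>Semirings of subsets of a monoid\<close>

lemma (in monoid) set_mult_assoc:
  assumes "X \<subseteq> carrier G" "Y \<subseteq> carrier G" "Z \<subseteq> carrier G"
  shows "(X <#> Y) <#> Z = X <#> (Y <#> Z)"
proof -
  have "(x \<otimes> y) \<otimes> z = x \<otimes> (y \<otimes> z)" if "x \<in> X" "y \<in> Y" "z \<in> Z" for x y z
    using that assms m_assoc by blast
  then show ?thesis
    by (auto simp: set_mult_def)
qed

lemma idem_semiring_power_semiring:
  assumes "monoid M"
  shows "idem_semiring (power_semiring M)"
proof -
  interpret monoid M by fact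
  have one: "{\<one>\<^bsub>M\<^esub>} <#>\<^bsub>M\<^esub> X = X" "X <#>\<^bsub>M\<^esub> {\<one>\<^bsub>M\<^esub>} = X" if "X \<subseteq> carrier M" for X
    using that l_one r_one unfolding set_mult_def by fastforce+
  have distr: "(X \<union> Y) <#>\<^bsub>M\<^esub> Z = (X <#>\<^bsub>M\<^esub> Z) \<union> (Y <#>\<^bsub>M\<^esub> Z)"
      "Z <#>\<^bsub>M\<^esub> (X \<union> Y) = (Z <#>\<^bsub>M\<^esub> X) \<union> (Z <#>\<^bsub>M\<^esub> Y)"
      "{} <#>\<^bsub>M\<^esub> X = {}" "X <#>\<^bsub>M\<^esub> {} = {}" for X Y Z
    by (auto simp: set_mult_def)
  have "abelian_monoid (power_semiring M)"
    by (rule abelian_monoidI) (auto simp: power_semiring_def)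
  moreover have "monoid (power_semiring M)"
    \<comment> \<open>Rotating the premises of \<open>set_mult_closed\<close> makes membership in
      the product the major premise of the destruction rule.\<close>
    by (rule monoidI) (auto simp: power_semiring_def one set_mult_assoc
        dest: set_mult_closed[THEN subsetD, rotated 2])
  moreover have "semiring_axioms (power_semiring M)"
    by (rule semiring_axioms.intro) (simp_all add: power_semiring_def distr)
  ultimately show ?thesis
    by (simp add: idem_semiring_def semiring.intro) (simp add: power_semiring_def)
qed

text \<open>The laws are equations, so they pass along a surjection that respects the operations.
  With \<open>p\<close> the map \<open>right_mult\<close>, the laws of \<open>TS\<close> follow from
  those of the power semiring.\<close>

lemma idem_semiring_image:
  assumes R: "idem_semiring R" and carr: "carrier S = p ` carrier R"
    and add: "\<And>x y. x \<in> carrier R \<Longrightarrow> y \<in> carrier R \<Longrightarrow> p x \<oplus>\<^bsub>S\<^esub> p y = p (x \<oplus>\<^bsub>R\<^esub> y)"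
    and mult: "\<And>x y. x \<in> carrier R \<Longrightarrow> y \<in> carrier R \<Longrightarrow> p x \<otimes>\<^bsub>S\<^esub> p y = p (x \<otimes>\<^bsub>R\<^esub> y)"
    and zero: "\<zero>\<^bsub>S\<^esub> = p \<zero>\<^bsub>R\<^esub>" and one: "\<one>\<^bsub>S\<^esub> = p \<one>\<^bsub>R\<^esub>"
  shows "idem_semiring S"
proof -
  interpret semiring R
    using R by (simp add: idem_semiring_def)
  have "abelian_monoid S"
    by (rule abelian_monoidI) (auto simp: carr add zero a_assoc intro: a_comm[THEN arg_cong])
  moreover have "monoid S"
    by (rule monoidI) (auto simp: carr mult one m_assoc)
  moreover have "semiring_axioms S"
    by (rule semiring_axioms.intro) (auto simp: carr add mult zero l_distr r_distr)
  moreover have "\<forall>x\<in>carrier S. x \<oplus>\<^bsub>S\<^esub> x = x"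
    using R by (auto simp: carr add idem_semiring_def)
  ultimately show ?thesis
    by (simp add: idem_semiring_def semiring.intro)
qed

section \<open>The right regular action of subsets of a monoid\<close>

definition right_mult :: "('m, 'b) monoid_scheme \<Rightarrow> 'm set \<Rightarrow> 'm set \<Rightarrow> 'm set" where
  "right_mult M S = (\<lambda>X\<in>Pow (carrier M). X <#>\<^bsub>M\<^esub> S)"

text \<open>The action is faithful: evaluation at the singleton of the unit is a left inverse of
  \<open>right_mult\<close>. This becomes the semiring isomorphism.\<close>

lemma (in monoid) right_mult_one: "S \<subseteq> carrier G \<Longrightarrow> right_mult G S {\<one>} = S"
  unfolding right_mult_def set_mult_def by force

text \<open>Evaluation at the singleton of the unit reflects the pointwise order, and monotonicity
  of the product preserves it.\<close>

lemma (in monoid) right_mult_le_iff: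
  assumes "S \<subseteq> carrier G" "T \<subseteq> carrier G"
  shows "(\<forall>X\<in>Pow (carrier G). right_mult G S X \<subseteq> right_mult G T X) \<longleftrightarrow> S \<subseteq> T"
proof
  assume "\<forall>X\<in>Pow (carrier G). right_mult G S X \<subseteq> right_mult G T X"
  then have "right_mult G S {\<one>} \<subseteq> right_mult G T {\<one>}"
    by (rule bspec) auto
  then show "S \<subseteq> T"
    using assms by (simp add: right_mult_one)
next
  assume "S \<subseteq> T"
  then show "\<forall>X\<in>Pow (carrier G). right_mult G S X \<subseteq> right_mult G T X"
    by (simp add: right_mult_def mono_set_mult)
qed

text \<open>Associativity of the elementwise product. \<open>S\<close> acts first, which matches the
  diagrammatic order of multiplication in \<open>TS\<close>.\<close>

lemma (in monoid) compose_right_mult: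
  assumes "S \<subseteq> carrier G" "T \<subseteq> carrier G"
  shows "compose (Pow (carrier G)) (right_mult G T) (right_mult G S) = right_mult G (S <#> T)"
proof
  fix X
  show "compose (Pow (carrier G)) (right_mult G T) (right_mult G S) X = right_mult G (S <#> T) X"
  proof (cases "X \<subseteq> carrier G")
    case True
    then have "X <#> S \<subseteq> carrier G"
      using assms(1) by (rule set_mult_closed)
    then show ?thesis
      using True assms by (simp add: compose_def right_mult_def set_mult_assoc)
  qed (simp add: compose_def right_mult_def)
qed

section \<open>The syntactic monoid\<close>

text \<open>Keeps membership in \<open>lists A\<close> from being split into statements about single
  letters.\<close>

declare in_listsD [rule del] in_listsI [rule del] lists.Nil [simp, intro]

lemma equiv_synt_cong: "equiv (lists A) (synt_cong A L)"
  by (rule equivI) (auto simp: synt_cong_def refl_on_def sym_def trans_def)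

lemma synt_class_eq_iff:
  assumes "u \<in> lists A" "v \<in> lists A"
  shows "synt_class A L u = synt_class A L v \<longleftrightarrow>
    (\<forall>x\<in>lists A. \<forall>y\<in>lists A. x @ u @ y \<in> L \<longleftrightarrow> x @ v @ y \<in> L)"
proof -
  have "synt_class A L u = synt_class A L v \<longleftrightarrow> (u, v) \<in> synt_cong A L"
    unfolding synt_class_def by (rule eq_equiv_class_iff[OF equiv_synt_cong assms])
  then show ?thesis
    using assms by (simp add: synt_cong_def)
qed

lemma mem_synt_class_iff:
  "w \<in> lists A \<Longrightarrow> u \<in> synt_class A L w \<longleftrightarrow> u \<in> lists A \<and> synt_class A L u = synt_class A L w"
  using synt_class_eq_iff[of w A u L] unfolding synt_class_def[of _ _ w]
  by (auto simp: synt_cong_def)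

lemma carrier_Syn: "carrier (Syn A L) = synt_class A L ` lists A"
  by (auto simp: Syn_def quotient_def synt_class_def)

lemma one_Syn: "\<one>\<^bsub>Syn A L\<^esub> = synt_class A L []"
  by (simp add: Syn_def)

text \<open>Two replacements in context: \<open>u\<close> by \<open>u'\<close> between
  \<open>x\<close> and \<open>v @ y\<close>, then \<open>v\<close> by \<open>v'\<close> between
  \<open>x @ u'\<close> and \<open>y\<close>.\<close>

lemma synt_class_append_cong:
  assumes "u \<in> lists A" "v \<in> lists A" "u' \<in> lists A" "v' \<in> lists A"
    and "synt_class A L u = synt_class A L u'" "synt_class A L v = synt_class A L v'"
  shows "synt_class A L (u @ v) = synt_class A L (u' @ v')"
proof -
  have "x @ (u @ v) @ y \<in> L \<longleftrightarrow> x @ (u' @ v') @ y \<in> L" if "x \<in> lists A" "y \<in> lists A" for x y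
  proof -
    have "x @ u @ (v @ y) \<in> L \<longleftrightarrow> x @ u' @ (v @ y) \<in> L"
      using assms that by (simp add: synt_class_eq_iff)
    moreover have "(x @ u') @ v @ y \<in> L \<longleftrightarrow> (x @ u') @ v' @ y \<in> L"
      using assms(6) that assms(1-4) by (subst (asm) synt_class_eq_iff) (auto simp del: append_assoc)
    ultimately show ?thesis
      by simp
  qed
  then show ?thesis
    using assms by (subst synt_class_eq_iff) auto
qed

text \<open>The union over all pairs of representatives collapses, because by congruence each pair
  yields the same class.\<close>

lemma mult_Syn:
  assumes "u \<in> lists A" "v \<in> lists A"
  shows "synt_class A L u \<otimes>\<^bsub>Syn A L\<^esub> synt_class A L v = synt_class A L (u @ v)"
proof -
  have "synt_class A L (u' @ v') = synt_class A L (u @ v)"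
    if "u' \<in> synt_class A L u" "v' \<in> synt_class A L v" for u' v'
    using that assms by (intro synt_class_append_cong) (auto simp: mem_synt_class_iff)
  moreover have "u \<in> synt_class A L u" "v \<in> synt_class A L v"
    using assms by (auto simp: mem_synt_class_iff)
  ultimately have "(\<Union>u'\<in>synt_class A L u. \<Union>v'\<in>synt_class A L v. synt_class A L (u' @ v')) =
      synt_class A L (u @ v)"
    by blast
  then show ?thesis
    by (simp add: Syn_def)
qed

lemma monoid_Syn: "monoid (Syn A L)"
  by (rule monoidI) (auto simp: carrier_Syn one_Syn mult_Syn)

text \<open>Words inducing the same transformation on a recognising automaton are congruent, and a
  finite automaton has finitely many transformations.\<close>

lemma finite_Syn:
  assumes "regular A L"
  shows "finite (carrier (Syn A L))"
proof -
  obtain D :: "(nat, 'a) dfa" where D: "finite_dfa A D" "dfa_lang A D = L"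
    using assms by (auto simp: regular_def)
  \<comment> \<open>The restriction to states places \<open>T w\<close> in a finite extensional
    function space.\<close>
  define T where "T = (\<lambda>w. \<lambda>q\<in>dfa_states D. fold (dfa_step D) w q)"
  have closed: "fold (dfa_step D) w q \<in> dfa_states D" if "w \<in> lists A" "q \<in> dfa_states D" for w q
    using that D(1) by (induction w arbitrary: q) (auto simp: finite_dfa_def)
  have "T ` lists A \<subseteq> dfa_states D \<rightarrow>\<^sub>E dfa_states D"
    using closed by (auto simp: T_def)
  then have fin: "finite (T ` lists A)"
    using D(1) finite_subset finite_PiE unfolding finite_dfa_def by metis
  have T: "synt_class A L u = synt_class A L v"
    if "u \<in> lists A" "v \<in> lists A" "T u = T v" for u v
  proof -
    have "fold (dfa_step D) u q = fold (dfa_step D) v q" if "q \<in> dfa_states D" for q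
      using \<open>T u = T v\<close> that by (metis T_def restrict_apply')
    then have "x @ u @ y \<in> L \<longleftrightarrow> x @ v @ y \<in> L" if "x \<in> lists A" "y \<in> lists A" for x y
      using that D closed[of x "dfa_init D"] \<open>u \<in> lists A\<close> \<open>v \<in> lists A\<close>
      by (auto simp: dfa_lang_def finite_dfa_def)
    then show ?thesis
      using that by (simp add: synt_class_eq_iff)
  qed
  \<comment> \<open>Choosing one word for each transformation exhibits the set of classes as the
    image of a finite set.\<close>
  have "synt_class A L w = synt_class A L (inv_into (lists A) T (T w))" if "w \<in> lists A" for w
    using that by (intro T) (auto intro: inv_into_into f_inv_into_f[symmetric])
  then have "synt_class A L ` lists A \<subseteq> (\<lambda>t. synt_class A L (inv_into (lists A) T t)) ` T ` lists A"
    by auto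
  then show ?thesis
    unfolding carrier_Syn using fin finite_surj by blast
qed

lemma rev_in_lists_iff [simp]: "rev w \<in> lists A \<longleftrightarrow> w \<in> lists A"
  by (simp add: in_lists_conv_set)

lemma LRP_Union: "finite F \<Longrightarrow> F \<subseteq> LRP A K \<Longrightarrow> \<Union>F \<in> LRP A K"
  by (induction F rule: finite_induct) (auto intro: LRP.intros)

text \<open>The empty intersection would be \<open>UNIV\<close>, which differs from
  \<open>lists A\<close> in general.\<close>

lemma LRP_Inter: "finite F \<Longrightarrow> F \<noteq> {} \<Longrightarrow> F \<subseteq> LRP A K \<Longrightarrow> \<Inter>F \<in> LRP A K"
  by (induction F rule: finite_ne_induct) (auto intro: LRP.intros)

section \<open>A fixed regular language and its syntactic classes\<close>

locale regular_language =
  fixes A :: "'a set" and L :: "'a list set"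
  assumes regular: "regular A L"
begin

abbreviation "M \<equiv> Syn A L"
abbreviation "cl \<equiv> synt_class A L"

definition \<delta> where "\<delta> = subset_construction (nfa_of_dfa (dfa_Syn A L))"

sublocale M: monoid M
  by (rule monoid_Syn)

lemma L_subset: "L \<subseteq> lists A"
  using regular by (auto simp: regular_def dfa_lang_def)

lemma cl_closed [simp]: "w \<in> lists A \<Longrightarrow> cl w \<in> carrier M"
  by (simp add: carrier_Syn)

text \<open>\<open>L\<close> is a union of syntactic classes: congruent words are compared in the
  empty context.\<close>

lemma cl_mem_image_iff:
  assumes "w \<in> lists A"
  shows "cl w \<in> cl ` L \<longleftrightarrow> w \<in> L"
proof
  assume "cl w \<in> cl ` L"
  then obtain v where v: "v \<in> L" "cl w = cl v"
    by auto
  then have "\<forall>x\<in>lists A. \<forall>y\<in>lists A. x @ w @ y \<in> L \<longleftrightarrow> x @ v @ y \<in> L"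
    using assms L_subset synt_class_eq_iff[of w A v L] by blast
  from this[THEN bspec, of "[]", THEN bspec, of "[]"] show "w \<in> L"
    using v by simp
qed simp

lemma cl_image_subset: "K \<subseteq> lists A \<Longrightarrow> cl ` K \<subseteq> carrier M"
  by (auto simp: carrier_Syn)

lemma subset_carrier_Syn: "S \<subseteq> carrier M \<longleftrightarrow> (\<exists>K\<subseteq>lists A. S = cl ` K)"
  unfolding carrier_Syn by (rule subset_image_iff)

section \<open>The transition semiring\<close>

lemma jlat_\<delta>: "jlat \<delta> = \<lparr>carrier = Pow (carrier M), eq = (=), le = (\<subseteq>)\<rparr>"
  by (simp add: \<delta>_def subset_construction_def nfa_of_dfa_def dfa_Syn_def)

lemma jinit_\<delta>: "jinit \<delta> = {\<one>\<^bsub>M\<^esub>}"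
  by (simp add: \<delta>_def subset_construction_def nfa_of_dfa_def dfa_Syn_def one_Syn)

lemma jstep_\<delta>: "X \<subseteq> carrier M \<Longrightarrow> jstep \<delta> a X = X <#>\<^bsub>M\<^esub> {cl [a]}"
  by (auto simp: \<delta>_def subset_construction_def nfa_of_dfa_def dfa_Syn_def set_mult_def)

lemma jfinal_\<delta>: "jfinal \<delta> = {X \<in> Pow (carrier M). X \<inter> cl ` L \<noteq> {}}"
  by (simp add: \<delta>_def subset_construction_def nfa_of_dfa_def dfa_Syn_def Setcompr_eq_image)

lemma jrun_\<delta>: "w \<in> lists A \<Longrightarrow> X \<subseteq> carrier M \<Longrightarrow> jrun \<delta> w X = X <#>\<^bsub>M\<^esub> {cl w}"
proof (induction w arbitrary: X)
  case Nil
  then show ?case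
    by (force simp: jrun_def set_mult_def simp flip: one_Syn)
next
  case (Cons a w)
  then have *: "X <#>\<^bsub>M\<^esub> {cl [a]} \<subseteq> carrier M"
    by (intro M.set_mult_closed) auto
  have "jrun \<delta> (a # w) X = (X <#>\<^bsub>M\<^esub> {cl [a]}) <#>\<^bsub>M\<^esub> {cl w}"
    using Cons.IH[OF _ *] Cons.prems by (simp add: jrun_def jstep_\<delta>)
  also have "\<dots> = X <#>\<^bsub>M\<^esub> ({cl [a]} <#>\<^bsub>M\<^esub> {cl w})"
    using Cons.prems by (intro M.set_mult_assoc) auto
  also have "{cl [a]} <#>\<^bsub>M\<^esub> {cl w} = {cl (a # w)}"
    using Cons.prems by (simp add: set_mult_def mult_Syn)
  finally show ?case .
qed

text \<open>The product distributes over unions, so joining the actions of the single words of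
  \<open>K\<close> gives the product with all their classes. Outside the powerset both functions are
  \<open>undefined\<close>, which makes them equal as functions.\<close>

lemma jact_\<delta>:
  assumes "K \<subseteq> lists A"
  shows "jact \<delta> K = right_mult M (cl ` K)"
proof
  fix X
  show "jact \<delta> K X = right_mult M (cl ` K) X"
  proof (cases "X \<subseteq> carrier M")
    case True
    have "{jrun \<delta> w X | w. w \<in> K} = (\<lambda>w. X <#>\<^bsub>M\<^esub> {cl w}) ` K"
      using assms True jrun_\<delta> by (auto simp: Setcompr_eq_image intro!: image_cong)
    moreover have "\<Union>((\<lambda>w. X <#>\<^bsub>M\<^esub> {cl w}) ` K) = X <#>\<^bsub>M\<^esub> cl ` K"
      by (auto simp: set_mult_def)
    moreover have "X <#>\<^bsub>M\<^esub> cl ` K \<subseteq> carrier M"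
      using M.set_mult_closed[OF True cl_image_subset[OF assms]] .
    moreover from calculation have "(\<lambda>w. X <#>\<^bsub>M\<^esub> {cl w}) ` K \<subseteq> Pow (carrier M)"
      by blast
    ultimately show ?thesis
      using True by (simp add: jact_def right_mult_def jlat_\<delta> sup_inclusion)
  qed (simp add: jact_def right_mult_def jlat_\<delta>)
qed

text \<open>Every set of syntactic classes is the set of classes of some set of words.\<close>

lemma TS_carrier_\<delta>: "TS_carrier A \<delta> = right_mult M ` Pow (carrier M)"
proof -
  have "TS_carrier A \<delta> = {right_mult M (cl ` K) | K. K \<subseteq> lists A}"
    unfolding TS_carrier_def using jact_\<delta> by metis
  also have "\<dots> = right_mult M ` {cl ` K | K. K \<subseteq> lists A}"
    by auto
  also have "{cl ` K | K. K \<subseteq> lists A} = Pow (carrier M)"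
    using subset_carrier_Syn by (simp only: set_eq_iff mem_Collect_eq Pow_iff) blast
  finally show ?thesis .
qed

lemma jlang_\<delta>: "jlang A \<delta> = L"
proof -
  have "jrun \<delta> w {\<one>\<^bsub>M\<^esub>} = {cl w}" if "w \<in> lists A" for w
    using that jrun_\<delta>[of w "{\<one>\<^bsub>M\<^esub>}"] by (simp add: set_mult_def)
  then have "jrun \<delta> w (jinit \<delta>) \<in> jfinal \<delta> \<longleftrightarrow> w \<in> L" if "w \<in> lists A" for w
    using that by (simp add: jinit_\<delta> jfinal_\<delta> cl_mem_image_iff)
  then show ?thesis
    using L_subset unfolding jlang_def acc_def by blast
qed

lemma restrict_id_eq: "(\<lambda>X\<in>Pow (carrier M). X) = right_mult M {\<one>\<^bsub>M\<^esub>}"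
  unfolding right_mult_def by (rule restrict_ext) (force simp: set_mult_def)

text \<open>These equations are the hypotheses that \<open>idem_semiring_image\<close> needs to
  carry the power semiring over to \<open>TS\<close>.\<close>

lemma TS_ops:
  shows "carrier (TS A \<delta>) = right_mult M ` Pow (carrier M)"
    and "S \<subseteq> carrier M \<Longrightarrow> T \<subseteq> carrier M \<Longrightarrow>
      right_mult M S \<otimes>\<^bsub>TS A \<delta>\<^esub> right_mult M T = right_mult M (S <#>\<^bsub>M\<^esub> T)"
    and "S \<subseteq> carrier M \<Longrightarrow> T \<subseteq> carrier M \<Longrightarrow>
      right_mult M S \<oplus>\<^bsub>TS A \<delta>\<^esub> right_mult M T = right_mult M (S \<union> T)"
    and "\<zero>\<^bsub>TS A \<delta>\<^esub> = right_mult M {}"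
    and "\<one>\<^bsub>TS A \<delta>\<^esub> = right_mult M {\<one>\<^bsub>M\<^esub>}"
proof -
  show "carrier (TS A \<delta>) = right_mult M ` Pow (carrier M)"
    by (simp add: TS_def TS_carrier_\<delta>)
  show "right_mult M S \<otimes>\<^bsub>TS A \<delta>\<^esub> right_mult M T = right_mult M (S <#>\<^bsub>M\<^esub> T)"
    if "S \<subseteq> carrier M" "T \<subseteq> carrier M"
    using M.compose_right_mult[OF that] by (simp add: TS_def jlat_\<delta>)
  show "right_mult M S \<oplus>\<^bsub>TS A \<delta>\<^esub> right_mult M T = right_mult M (S \<union> T)"
    if "S \<subseteq> carrier M" "T \<subseteq> carrier M"
  proof -
    have "right_mult M S X \<squnion>\<^bsub>jlat \<delta>\<^esub> right_mult M T X = X <#>\<^bsub>M\<^esub> (S \<union> T)"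
      if X: "X \<in> Pow (carrier M)" for X
    proof -
      have "X <#>\<^bsub>M\<^esub> S \<subseteq> carrier M" "X <#>\<^bsub>M\<^esub> T \<subseteq> carrier M"
        using X \<open>S \<subseteq> carrier M\<close> \<open>T \<subseteq> carrier M\<close> by (simp_all add: M.set_mult_closed)
      then show ?thesis
        using X by (simp add: jlat_\<delta> join_def sup_inclusion right_mult_def) (auto simp: set_mult_def)
    qed
    then show ?thesis
      by (auto simp: TS_def jlat_\<delta> right_mult_def[of M "S \<union> T"] intro!: restrict_ext)
  qed
  have "\<bottom>\<^bsub>jlat \<delta>\<^esub> = {}"
    unfolding bottom_def by (rule some_equality) (auto simp: jlat_\<delta> least_def)
  then show "\<zero>\<^bsub>TS A \<delta>\<^esub> = right_mult M {}"
    by (simp add: TS_def jlat_\<delta> right_mult_def set_mult_def)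
  show "\<one>\<^bsub>TS A \<delta>\<^esub> = right_mult M {\<one>\<^bsub>M\<^esub>}"
    by (simp add: TS_def jlat_\<delta> restrict_id_eq)
qed

text \<open>Evaluation at the singleton of the unit depends only on the function and not on a set of
  words inducing it, so well-definedness is automatic. Its inverse is
  \<open>right_mult M\<close>.\<close>

lemma TS_iso: "(\<lambda>f. f {\<one>\<^bsub>M\<^esub>}) \<in> idem_semiring_iso (TS A \<delta>) (power_semiring M)"
proof -
  let ?h = "\<lambda>f. f {\<one>\<^bsub>M\<^esub>}"
  have P: "idem_semiring (power_semiring M)"
    by (rule idem_semiring_power_semiring[OF M.monoid_axioms])
  have R: "idem_semiring (TS A \<delta>)"
    by (rule idem_semiring_image[OF P, where p = "right_mult M"])
      (auto simp: TS_ops power_semiring_def)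
  have h: "?h (right_mult M S) = S" if "S \<subseteq> carrier M" for S
    using that by (rule M.right_mult_one)
  have "?h \<in> ring_hom (TS A \<delta>) (power_semiring M)"
    by (rule ring_hom_memI) (auto simp: TS_ops h power_semiring_def M.set_mult_closed
        dest: M.set_mult_closed[THEN subsetD, rotated 2])
  moreover have "bij_betw ?h (carrier (TS A \<delta>)) (carrier (power_semiring M))"
    by (rule bij_betw_byWitness[where f' = "right_mult M"]) (auto simp: TS_ops h power_semiring_def)
  ultimately show ?thesis
    using P R h[of "{}"] by (simp add: idem_semiring_iso_def ring_iso_def TS_ops)
      (simp add: power_semiring_def)
qed

section \<open>The boolean syntactic JSL-dfa\<close>

text \<open>The reversal of the language that \<open>S\<close> recognises through the syntactic
  morphism.\<close>

definition rev_words :: "'a list set set \<Rightarrow> 'a list set" where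
  "rev_words S = {w \<in> lists A. cl (rev w) \<in> S}"

text \<open>Each class in \<open>S\<close> has a representative, whose reversal witnesses the class
  inside \<open>rev_words S\<close>. Hence \<open>rev_words\<close> is an order embedding on sets of
  classes.\<close>

lemma rev_words_subset_iff:
  assumes "S \<subseteq> carrier M"
  shows "rev_words S \<subseteq> rev_words T \<longleftrightarrow> S \<subseteq> T"
proof
  assume ST: "rev_words S \<subseteq> rev_words T"
  show "S \<subseteq> T"
  proof
    fix m assume m: "m \<in> S"
    then obtain w where w: "w \<in> lists A" "m = cl w"
      using assms by (auto simp: carrier_Syn)
    then have "rev w \<in> rev_words S"
      using m by (simp add: rev_words_def)
    then have "rev w \<in> rev_words T"
      using ST by blast
    then show "m \<in> T"
      using w by (simp add: rev_words_def)
  qed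
qed (auto simp: rev_words_def)

lemma mem_rev_image_iff: "w \<in> rev ` L \<longleftrightarrow> rev w \<in> L"
  by (metis image_iff rev_rev_ident)

lemma mem_quotient_iff:
  assumes "u \<in> lists A" "v \<in> lists A" "w \<in> lists A"
  shows "w \<in> two_sided_quotient A u (rev ` L) v \<longleftrightarrow> rev v @ rev w @ rev u \<in> L"
  using assms by (simp add: two_sided_quotient_def mem_rev_image_iff)

text \<open>\<open>rev_words\<close> turns boolean operations on sets of classes into those on
  languages, so only the quotients need work. Reversal swaps their sides: \<open>u\<close>
  multiplies on the right and \<open>v\<close> on the left.\<close>

lemma LRP_subset: "LRP A (rev ` L) \<subseteq> rev_words ` Pow (carrier M)"
proof
  fix X assume "X \<in> LRP A (rev ` L)"
  then show "X \<in> rev_words ` Pow (carrier M)"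
  proof (induction rule: LRP.induct)
    case (quot u v)
    have "two_sided_quotient A u (rev ` L) v =
        rev_words {m \<in> carrier M. cl (rev v) \<otimes>\<^bsub>M\<^esub> (m \<otimes>\<^bsub>M\<^esub> cl (rev u)) \<in> cl ` L}"
      (is "_ = rev_words ?S")
    proof (rule Set.set_eqI)
      fix w
      show "w \<in> two_sided_quotient A u (rev ` L) v \<longleftrightarrow> w \<in> rev_words ?S"
      proof (cases "w \<in> lists A")
        case True
        then show ?thesis
          using quot by (simp add: mem_quotient_iff rev_words_def mult_Syn cl_mem_image_iff)
      qed (simp add: two_sided_quotient_def rev_words_def)
    qed
    then show ?case
      by blast
  next
    case empty
    have "{} = rev_words {}"
      by (simp add: rev_words_def)
    then show ?case
      by blast
  next
    case full
    have "lists A = rev_words (carrier M)"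
      by (auto simp: rev_words_def)
    then show ?case
      by blast
  next
    case (compl X)
    then obtain S where "X = rev_words S"
      by blast
    then have "lists A - X = rev_words (carrier M - S)"
      by (auto simp: rev_words_def)
    then show ?case
      by blast
  next
    case (union X Y)
    then obtain S T where "X = rev_words S" "Y = rev_words T" "S \<subseteq> carrier M" "T \<subseteq> carrier M"
      by blast
    then have "X \<union> Y = rev_words (S \<union> T)" "S \<union> T \<in> Pow (carrier M)"
      by (auto simp: rev_words_def)
    then show ?case
      by blast
  next
    case (inter X Y)
    then obtain S T where "X = rev_words S" "Y = rev_words T" "S \<subseteq> carrier M" "T \<subseteq> carrier M"
      by blast
    then have "X \<inter> Y = rev_words (S \<inter> T)" "S \<inter> T \<in> Pow (carrier M)"
      by (auto simp: rev_words_def)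
    then show ?case
      by blast
  qed
qed

lemma finite_LRP: "finite (LRP A (rev ` L))"
  using finite_Syn[OF regular] by (intro finite_subset[OF LRP_subset]) simp

text \<open>A reversed syntactic class is the smallest member of \<open>LRP\<close> containing a given word of it.\<close>

lemma rev_words_singleton_in_LRP:
  assumes v: "v \<in> lists A"
  shows "rev_words {cl v} \<in> LRP A (rev ` L)"
proof -
  let ?F = "{X \<in> LRP A (rev ` L). rev v \<in> X}"
  have full: "lists A \<in> ?F"
    using v by (simp add: LRP.full)
  have "rev_words {cl v} = \<Inter>?F"
  proof (intro subset_antisym subsetI)
    fix w assume w: "w \<in> rev_words {cl v}"
    have "w \<in> X" if X: "X \<in> ?F" for X
    proof -
      \<comment> \<open>Membership in \<open>X\<close> depends only on the class of the reversed
        word, and \<open>w\<close> shares that class with \<open>rev v\<close>.\<close>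
      obtain S where "X = rev_words S"
        using X LRP_subset by blast
      then show ?thesis
        using X w by (simp add: rev_words_def)
    qed
    then show "w \<in> \<Inter>?F"
      by blast
  next
    fix w assume w: "w \<in> \<Inter>?F"
    then have wA: "w \<in> lists A"
      using full by blast
    have "x @ rev w @ y \<in> L \<longleftrightarrow> x @ v @ y \<in> L" if "x \<in> lists A" "y \<in> lists A" for x y
    proof -
      \<comment> \<open>This quotient tests the context \<open>x\<close>, \<open>y\<close>: it
        contains \<open>w\<close> exactly when \<open>x @ rev w @ y\<close> lies in
        \<open>L\<close>.\<close>
      let ?Q = "two_sided_quotient A (rev y) (rev ` L) (rev x)"
      have Q: "?Q \<in> LRP A (rev ` L)"
        using that by (simp add: LRP.quot)
      have "w \<in> ?Q \<longleftrightarrow> rev v \<in> ?Q"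
      proof (cases "rev v \<in> ?Q")
        case True
        then show ?thesis
          using w Q by blast
      next
        case False
        \<comment> \<open>When \<open>rev v\<close> fails the test, the complement belongs to the
          intersected family and forces \<open>w\<close> to fail as well.\<close>
        then have "lists A - ?Q \<in> ?F"
          using v Q by (simp add: LRP.compl)
        then show ?thesis
          using w False by blast
      qed
      then show ?thesis
        using that v wA by (simp add: mem_quotient_iff)
    qed
    then show "w \<in> rev_words {cl v}"
      using v wA by (simp add: rev_words_def synt_class_eq_iff)
  qed
  moreover have "\<Inter>?F \<in> LRP A (rev ` L)"
    using finite_LRP full by (intro LRP_Inter) auto
  ultimately show ?thesis
    by simp
qed

text \<open>Finiteness of the syntactic monoid makes every set of classes a finite union of
  singletons, whose languages are already in \<open>LRP\<close>.\<close>

lemma LRP_eq: "LRP A (rev ` L) = rev_words ` Pow (carrier M)"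
proof
  show "rev_words ` Pow (carrier M) \<subseteq> LRP A (rev ` L)"
  proof clarify
    fix S assume S: "S \<subseteq> carrier M"
    then have "(\<lambda>m. rev_words {m}) ` S \<subseteq> LRP A (rev ` L)"
      using rev_words_singleton_in_LRP by (auto simp: carrier_Syn)
    moreover have "finite S"
      using S finite_Syn[OF regular] finite_subset by blast
    moreover have "rev_words S = \<Union>((\<lambda>m. rev_words {m}) ` S)"
      by (auto simp: rev_words_def)
    ultimately show "rev_words S \<in> LRP A (rev ` L)"
      using LRP_Union[of "(\<lambda>m. rev_words {m}) ` S"] by simp
  qed
qed (rule LRP_subset)

lemma rev_L_eq: "rev ` L = rev_words (cl ` L)"
proof -
  have "cl (rev w) \<in> cl ` L \<longleftrightarrow> rev w \<in> L" if "w \<in> lists A" for w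
    using that by (simp add: cl_mem_image_iff)
  moreover have "w \<in> lists A" if "rev w \<in> L" for w
    using that L_subset rev_in_lists_iff by blast
  ultimately show ?thesis
    by (intro Set.set_eqI) (auto simp only: rev_words_def mem_rev_image_iff mem_Collect_eq)
qed

text \<open>The right adjoint of multiplication by the class of \<open>a\<close>: the largest
  \<open>T\<close> whose product with that class lies inside \<open>S\<close>.\<close>

definition preimage :: "'a \<Rightarrow> 'a list set set \<Rightarrow> 'a list set set" where
  "preimage a S = {m \<in> carrier M. m \<otimes>\<^bsub>M\<^esub> cl [a] \<in> S}"

lemma preimage_subset: "preimage a S \<subseteq> carrier M"
  by (auto simp: preimage_def)

text \<open>Prepending \<open>a\<close> to a word appends it to the reversed word, hence multiplies
  the class on the right.\<close>

lemma quotient_rev_words: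
  assumes "a \<in> A"
  shows "two_sided_quotient A [a] (rev_words S) [] = rev_words (preimage a S)"
  using assms by (auto simp: two_sided_quotient_def rev_words_def preimage_def mult_Syn)

lemma jsl_dfa_dfa_neg_Syn: "jsl_dfa A (dfa_neg_Syn A (rev ` L))"
proof -
  let ?E = "dfa_neg_Syn A (rev ` L)"
  let ?C = "LRP A (rev ` L)"
  have lat: "jlat ?E = \<lparr>carrier = ?C, eq = (=), le = (\<subseteq>)\<rparr>"
    by (simp add: dfa_neg_Syn_def)
  have Un: "\<Union>X \<in> ?C" if "X \<subseteq> ?C" for X
    using that finite_LRP finite_subset LRP_Union by metis
  have "finite_jsl (jlat ?E)"
    unfolding finite_jsl_iff lat using partial_order_inclusion is_lub_inclusion Un finite_LRP
    by (metis partial_object.select_convs(1))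
  moreover have "jinit ?E \<in> ?C"
    using cl_image_subset[OF L_subset] by (simp add: dfa_neg_Syn_def LRP_eq) (simp add: rev_L_eq)
  moreover have "jstep ?E a \<in> jsl_hom (jlat ?E) (jlat ?E)" if a: "a \<in> A" for a
  proof -
    have st: "jstep ?E a X \<in> ?C" if "X \<in> ?C" for X
      using that a preimage_subset
      by (auto simp: LRP_eq quotient_rev_words dfa_neg_Syn_def)
    have "jstep ?E a (\<Union>X) = \<Union>(jstep ?E a ` X)" for X
      by (auto simp: dfa_neg_Syn_def two_sided_quotient_def)
    moreover have "jstep ?E a ` X \<subseteq> ?C" if "X \<subseteq> ?C" for X
      using that st by blast
    ultimately show ?thesis
      using st Un unfolding jsl_hom_def lat by (auto simp: sup_inclusion)
  qed
  moreover have "\<exists>t\<in>?C. jfinal ?E = {s \<in> ?C. \<not> s \<subseteq> t}"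
  proof (rule bexI)
    \<comment> \<open>The threshold is the largest member of \<open>LRP\<close> that omits the empty
      word: a member escapes it exactly when its set of classes contains the unit.\<close>
    show "rev_words (carrier M - {\<one>\<^bsub>M\<^esub>}) \<in> ?C"
      by (auto simp: LRP_eq)
    have "[] \<in> rev_words S \<longleftrightarrow> \<not> rev_words S \<subseteq> rev_words (carrier M - {\<one>\<^bsub>M\<^esub>})"
      if "S \<subseteq> carrier M" for S
      using that by (auto simp: rev_words_subset_iff rev_words_def one_Syn)
    then show "jfinal ?E = {s \<in> ?C. \<not> s \<subseteq> rev_words (carrier M - {\<one>\<^bsub>M\<^esub>})}"
      by (auto simp: dfa_neg_Syn_def LRP_eq)
  qed
  ultimately show ?thesis
    unfolding jsl_dfa_def by (simp add: lat)
qed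

section \<open>The dual of the transition JSL-dfa\<close>

abbreviation "D \<equiv> ts A \<delta>"
abbreviation "rm \<equiv> right_mult M"

lemma jstates_ts: "jstates D = rm ` Pow (carrier M)"
  by (simp add: ts_def TS_carrier_\<delta>)

lemma le_ts_iff:
  assumes "S \<subseteq> carrier M" "T \<subseteq> carrier M"
  shows "rm S \<sqsubseteq>\<^bsub>jlat D\<^esub> rm T \<longleftrightarrow> S \<subseteq> T"
  using M.right_mult_le_iff[OF assms] by (simp add: ts_def jlat_\<delta>)

lemma partial_order_ts: "partial_order (jlat D)"
proof -
  have eq: "eq (jlat D) = (=)"
    by (simp add: ts_def)
  show ?thesis
    by unfold_locales (auto simp: eq jstates_ts le_ts_iff)
qed

lemma jinit_ts: "jinit D = rm {\<one>\<^bsub>M\<^esub>}"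
  by (simp add: ts_def jlat_\<delta> restrict_id_eq)

lemma jstep_ts:
  assumes "a \<in> A" "S \<subseteq> carrier M"
  shows "jstep D a (rm S) = rm (S <#>\<^bsub>M\<^esub> {cl [a]})"
proof -
  have "compose (Pow (carrier M)) (jstep \<delta> a) (rm S) = compose (Pow (carrier M)) (rm {cl [a]}) (rm S)"
    using assms(2) by (auto simp: compose_def right_mult_def jstep_\<delta> M.set_mult_closed
        dest: M.set_mult_closed[THEN subsetD, rotated 2] intro!: restrict_ext)
  then show ?thesis
    using M.compose_right_mult[OF assms(2), of "{cl [a]}"] assms(1) by (simp add: ts_def jlat_\<delta>)
qed

text \<open>As \<open>\<delta>\<close> accepts \<open>L\<close>, the nonfinal states form the
  principal ideal below the action of the complement of \<open>L\<close>. Its generator becomes the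
  initial state of the dual.\<close>

lemma final_ts: "jstates D - jfinal D = rm ` Pow (cl ` (lists A - L))"
proof -
  have K: "cl ` (lists A - L) \<subseteq> carrier M"
    by (simp add: cl_image_subset)
  have "jfinal D = {f \<in> jstates D. \<not> f \<sqsubseteq>\<^bsub>jlat D\<^esub> rm (cl ` (lists A - L))}"
    by (simp add: ts_def jlang_\<delta> jact_\<delta>)
  then have "jstates D - jfinal D = {f \<in> rm ` Pow (carrier M). f \<sqsubseteq>\<^bsub>jlat D\<^esub> rm (cl ` (lists A - L))}"
    by (auto simp: jstates_ts)
  also have "\<dots> = rm ` {S \<in> Pow (carrier M). S \<subseteq> cl ` (lists A - L)}"
    using K le_ts_iff by auto
  also have "{S \<in> Pow (carrier M). S \<subseteq> cl ` (lists A - L)} = Pow (cl ` (lists A - L))"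
    using K by auto
  finally show ?thesis .
qed

lemma jstates_dual: "jstates (jdual D) = rm ` Pow (carrier M)"
  by (simp add: jdual_def jstates_ts)

lemma jinit_dual: "jinit (jdual D) = rm (cl ` (lists A - L))"
proof -
  have K: "cl ` (lists A - L) \<subseteq> carrier M"
    by (simp add: cl_image_subset)
  then have "greatest (jlat D) (rm (cl ` (lists A - L))) (jstates D - jfinal D)"
    unfolding greatest_def final_ts by (auto simp: jstates_ts le_ts_iff)
  then show ?thesis
    using partial_order.sup_greatest[OF partial_order_ts] by (simp add: jdual_def)
qed

text \<open>By adjointness the states joined in the dual transition form a principal ideal,
  generated by the action of \<open>preimage a S\<close>.\<close>

lemma jstep_dual:
  assumes "a \<in> A" "S \<subseteq> carrier M"
  shows "jstep (jdual D) a (rm S) = rm (preimage a S)"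
proof -
  have "T <#>\<^bsub>M\<^esub> {cl [a]} \<subseteq> S \<longleftrightarrow> T \<subseteq> preimage a S" if "T \<subseteq> carrier M" for T
    using that by (auto simp: set_mult_def preimage_def)
  moreover have "T <#>\<^bsub>M\<^esub> {cl [a]} \<subseteq> carrier M" if "T \<subseteq> carrier M" for T
    using that assms(1) by (intro M.set_mult_closed) auto
  ultimately have "jstep D a (rm T) \<sqsubseteq>\<^bsub>jlat D\<^esub> rm S \<longleftrightarrow> T \<subseteq> preimage a S" if "T \<subseteq> carrier M" for T
    using that assms by (simp add: jstep_ts le_ts_iff)
  then have "{f \<in> jstates D. jstep D a f \<sqsubseteq>\<^bsub>jlat D\<^esub> rm S} = rm ` Pow (preimage a S)"
    using preimage_subset[of a S] by (auto simp: jstates_ts)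
  moreover have "greatest (jlat D) (rm (preimage a S)) (rm ` Pow (preimage a S))"
    using preimage_subset[of a S] unfolding greatest_def by (auto simp: jstates_ts le_ts_iff)
  ultimately show ?thesis
    using partial_order.sup_greatest[OF partial_order_ts] by (simp add: jdual_def)
qed

lemma rm_mem_jfinal_dual_iff:
  "S \<subseteq> carrier M \<Longrightarrow> rm S \<in> jfinal (jdual D) \<longleftrightarrow> \<one>\<^bsub>M\<^esub> \<notin> S"
  by (simp add: jdual_def jinit_ts jstates_ts le_ts_iff)

text \<open>Preimages compose contravariantly: the first letter read is the rightmost factor, which
  is where the reversal comes from.\<close>

lemma jrun_dual:
  "w \<in> lists A \<Longrightarrow> S \<subseteq> carrier M \<Longrightarrow>
    jrun (jdual D) w (rm S) = rm {m \<in> carrier M. m \<otimes>\<^bsub>M\<^esub> cl (rev w) \<in> S}"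
proof (induction w arbitrary: S)
  case Nil
  then have "{m \<in> carrier M. m \<otimes>\<^bsub>M\<^esub> cl [] \<in> S} = S"
    using M.r_one by (auto simp flip: one_Syn)
  then show ?case
    by (simp add: jrun_def)
next
  case (Cons a w)
  have "{m \<in> carrier M. m \<otimes>\<^bsub>M\<^esub> cl (rev w) \<in> preimage a S} =
      {m \<in> carrier M. m \<otimes>\<^bsub>M\<^esub> cl (rev (a # w)) \<in> S}"
    using Cons.prems by (auto simp: preimage_def M.m_assoc mult_Syn)
  then show ?case
    using Cons.IH[OF _ preimage_subset, of a S] Cons.prems by (simp add: jrun_def jstep_dual)
qed

text \<open>A dual state is final when its set of classes omits the unit; after reading
  \<open>w\<close> this says that the class of \<open>rev w\<close> is not in
  \<open>S\<close>.\<close>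

lemma acc_dual:
  assumes "S \<subseteq> carrier M"
  shows "acc A (jdual D) (rm S) = rev_words (carrier M - S)"
  using assms by (auto simp: acc_def rev_words_def jrun_dual rm_mem_jfinal_dual_iff)

text \<open>Acceptance is complementation followed by \<open>rev_words\<close>. Complementation
  undoes the order reversal of the dual, and \<open>rev_words\<close> embeds the sets of classes
  onto \<open>LRP\<close>.\<close>

lemma acc_dual_iso: "acc A (jdual D) \<in> jdfa_iso A (jdual D) (dfa_neg_Syn A (rev ` L))"
proof (rule jdfa_isoI)
  let ?E = "dfa_neg_Syn A (rev ` L)"
  let ?acc = "acc A (jdual D)"
  have E: "jstates ?E = rev_words ` Pow (carrier M)" "le (jlat ?E) = (\<subseteq>)"
      "jinit ?E = rev ` L" "jstep ?E = (\<lambda>a X. two_sided_quotient A [a] X [])"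
    by (simp_all add: dfa_neg_Syn_def LRP_eq)
  show "jsl_dfa A ?E"
    by (rule jsl_dfa_dfa_neg_Syn)
  show "partial_order (jlat (jdual D))"
    using partial_order.dual_order[OF partial_order_ts] by (simp add: jdual_def)
  show le: "?acc x \<sqsubseteq>\<^bsub>jlat ?E\<^esub> ?acc y \<longleftrightarrow> x \<sqsubseteq>\<^bsub>jlat (jdual D)\<^esub> y"
    if xy: "x \<in> jstates (jdual D)" "y \<in> jstates (jdual D)" for x y
  proof -
    obtain S T where "x = rm S" "S \<subseteq> carrier M" "y = rm T" "T \<subseteq> carrier M"
      using xy unfolding jstates_dual by blast
    moreover have "le (jlat (jdual D)) = (\<lambda>x y. y \<sqsubseteq>\<^bsub>jlat D\<^esub> x)"
      by (simp add: jdual_def)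
    ultimately show ?thesis
      by (auto simp: E acc_dual rev_words_subset_iff le_ts_iff)
  qed
  show "bij_betw ?acc (jstates (jdual D)) (jstates ?E)"
    unfolding bij_betw_def
  proof
    show "inj_on ?acc (jstates (jdual D))"
    proof (rule inj_onI)
      fix x y assume xy: "x \<in> jstates (jdual D)" "y \<in> jstates (jdual D)" "?acc x = ?acc y"
      then have "x \<sqsubseteq>\<^bsub>jlat (jdual D)\<^esub> y" "y \<sqsubseteq>\<^bsub>jlat (jdual D)\<^esub> x"
        using le[of x y] le[of y x] by (simp_all add: E)
      then show "x = y"
        using xy partial_order.le_antisym[OF partial_order_ts] by (simp add: jdual_def)
    qed
    have "?acc ` jstates (jdual D) = rev_words ` (\<lambda>S. carrier M - S) ` Pow (carrier M)"
      unfolding jstates_dual image_image by (rule image_cong) (auto simp: acc_dual)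
    also have "(\<lambda>S. carrier M - S) ` Pow (carrier M) = Pow (carrier M)"
      by (auto simp: image_iff intro: exI[of _ "carrier M - S" for S])
    finally show "?acc ` jstates (jdual D) = jstates ?E"
      by (simp add: E)
  qed
  have K: "cl ` (lists A - L) \<subseteq> carrier M"
    by (simp add: cl_image_subset)
  then show "jinit (jdual D) \<in> jstates (jdual D)"
    by (simp add: jinit_dual jstates_dual)
  \<comment> \<open>Since \<open>L\<close> is a union of classes, no class meets both
    \<open>L\<close> and its complement.\<close>
  have compl: "cl w \<in> cl ` (lists A - L) \<longleftrightarrow> w \<notin> L" if "w \<in> lists A" for w
  proof
    assume "cl w \<in> cl ` (lists A - L)"
    then obtain v where "v \<in> lists A" "v \<notin> L" "cl w = cl v"
      by blast
    then show "w \<notin> L"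
      using cl_mem_image_iff[of v] cl_mem_image_iff[of w] that by simp
  qed (use that in blast)
  show "?acc (jinit (jdual D)) = jinit ?E"
  proof (rule Set.set_eqI)
    fix w
    have "w \<in> ?acc (jinit (jdual D)) \<longleftrightarrow> w \<in> lists A \<and> rev w \<in> L"
      unfolding jinit_dual acc_dual[OF K] rev_words_def using compl[of "rev w"] by auto
    also have "\<dots> \<longleftrightarrow> w \<in> jinit ?E"
      unfolding E mem_rev_image_iff using L_subset rev_in_lists_iff by blast
    finally show "w \<in> ?acc (jinit (jdual D)) \<longleftrightarrow> w \<in> jinit ?E" .
  qed
  show "jstep (jdual D) a x \<in> jstates (jdual D)" if "a \<in> A" "x \<in> jstates (jdual D)" for a x
    using that preimage_subset by (auto simp: jstates_dual jstep_dual)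
  show "?acc (jstep (jdual D) a x) = jstep ?E a (?acc x)"
    if "a \<in> A" "x \<in> jstates (jdual D)" for a x
    \<comment> \<open>Immediate from acceptance: the language after reading \<open>a\<close> is the
      left quotient by \<open>a\<close>.\<close>
    using that by (auto simp: E acc_def two_sided_quotient_def jrun_def)
  show "jfinal (jdual D) \<subseteq> jstates (jdual D)"
    by (auto simp: jdual_def)
  show "?acc x \<in> jfinal ?E \<longleftrightarrow> x \<in> jfinal (jdual D)" if "x \<in> jstates (jdual D)" for x
  proof -
    have "?acc x \<in> LRP A (rev ` L)"
      using that by (auto simp: jstates_dual acc_dual LRP_eq)
    then show ?thesis
      by (simp add: dfa_neg_Syn_def acc_def jrun_def)
  qed
qed

end

theorem corollary3p7p17:
  fixes A :: "'a set" and L :: "'a list set"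
  assumes "finite A" and "regular A L"
  shows "let \<delta> = subset_construction (nfa_of_dfa (dfa_Syn A L)) in
    (\<exists>h. (\<forall>U. U \<subseteq> lists A \<longrightarrow> h (jact \<delta> U) = {synt_class A L u | u. u \<in> U}) \<and>
         h \<in> idem_semiring_iso (TS A \<delta>) (power_semiring (Syn A L))) \<and>
    acc A (jdual (ts A \<delta>)) \<in>
      jdfa_iso A (jdual (ts A \<delta>)) (dfa_neg_Syn A (rev ` L))"
proof -
  interpret regular_language A L
    by unfold_locales (rule assms)
  \<comment> \<open>Identifies evaluation at the singleton of the unit with the prescribed map, so
    it serves as the witness \<open>h\<close>.\<close>
  have "jact \<delta> U {\<one>\<^bsub>M\<^esub>} = {cl u | u. u \<in> U}" if "U \<subseteq> lists A" for U
    using that cl_image_subset[OF that] by (simp add: jact_\<delta> M.right_mult_one Setcompr_eq_image)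
  then show ?thesis
    using TS_iso acc_dual_iso unfolding Let_def \<delta>_def[symmetric]
    by (intro conjI exI[of _ "\<lambda>f. f {\<one>\<^bsub>M\<^esub>}"] allI impI)
qed

end
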